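(* Let $n\ge 1$ be an integer, $s\in(0,1)$ and $\alpha\ge 0$. For $1\le p<\infty$ consider the inequality $$ \int_{\mathbb{R}^n} \frac{|(\mathbb{P}_s u)(x,y)|^p}{(|x|^2+y^2)^{\alpha}}\,dx\le C_p\int_{\mathbb{R}^n} \frac{|u(x)|^p}{(|x|^2+y^2)^{\alpha}}\,dx, \qquad ( * ) $$ where $\mathbb{P}_s u$ is the $s$-harmonic extension of $u$ and the constant $C_p>0$ does not depend on $y>0$ or on $u$. (i) If $p=1$, the inequality $( * )$ holds (with some finite constant $C_1$) if and only if $\alpha\le \frac n2+s$. (ii) For arbitrary $1<p<\infty$, the inequality $( * )$ holds (with some finite constant $C_p$) if and only if $\alpha<\frac n2+sp$.
   Context: For $s\in(0,1)$ and a measurable function $u:\mathbb{R}^n\to\mathbb{R}$, the generalized $s$-harmonic extension of $u$ to the half-space $\mathbb{R}^{n}\times(0,\infty)$ is $$ (\mathbb{P}_s u)(x,y)=c_{n,s}\int_{\mathbb{R}^n} u(\xi)\,\frac{y^{2s}}{(|x-\xi|^2+y^2)^{\frac{n+2s}{2}}}\,d\xi,\qquad x\in\mathbb{R}^n,\ y>0,\qquad c_{n,s}=\frac{\Gamma\big(\frac{n+2s}{2}\big)}{\pi^{n/2}\,\Gamma(s)}. $$ "The inequality $( * )$ holds" means: there is a finite constant $C_p>0$, which may depend on $n,s,\alpha,p$ but not on $y$ or $u$, such that for every $y>0$ and every measurable $u$ for which the right-hand side of $( * )$ is finite, the integral defining $(\mathbb{P}_s u)(x,y)$ converges absolutely for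 a.e. $x\in\mathbb{R}^n$ and $( * )$ is satisfied. *)

theory Defs
  imports "HOL-Analysis.Analysis"
begin

definition harmonic_ext_const :: "nat \<Rightarrow> real \<Rightarrow> real"
  where "harmonic_ext_const n s =
    Gamma ((real n + 2 * s) / 2) / (pi powr (real n / 2) * Gamma s)"

definition harmonic_ext_integrand ::
  "real \<Rightarrow> (real ^ 'n \<Rightarrow> real) \<Rightarrow> real ^ 'n \<Rightarrow> real \<Rightarrow> real ^ 'n \<Rightarrow> real"
  where "harmonic_ext_integrand s u x y \<xi> =
    u \<xi> * (y powr (2 * s) / ((norm (x - \<xi>))\<^sup>2 + y\<^sup>2) powr ((real CARD('n) + 2 * s) / 2))"

text \<open>
  The integral is a Bochner integral, hence \<open>0\<close> by convention wherever it does not converge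
  absolutely; convergence is therefore asserted separately in \<open>weighted_bound_holds\<close> below.
\<close>

definition harmonic_ext ::
  "real \<Rightarrow> (real ^ 'n \<Rightarrow> real) \<Rightarrow> real ^ 'n \<Rightarrow> real \<Rightarrow> real"
  where "harmonic_ext s u x y =
    harmonic_ext_const CARD('n) s * (LINT \<xi>|lebesgue. harmonic_ext_integrand s u x y \<xi>)"

definition weighted_integral ::
  "real \<Rightarrow> real \<Rightarrow> real \<Rightarrow> (real ^ 'n \<Rightarrow> real) \<Rightarrow> ennreal"
  where "weighted_integral \<alpha> p y f =
    (\<integral>\<^sup>+ x. ennreal (\<bar>f x\<bar> powr p / ((norm x)\<^sup>2 + y\<^sup>2) powr \<alpha>) \<partial>lebesgue)"

text \<open>
  The type argument only selects the space \<open>real ^ 'n\<close>. For \<open>C > 0\<close>, the right-hand side of the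
  inequality is finite iff its integral is.
\<close>

definition weighted_bound_holds :: "'n::finite itself \<Rightarrow> real \<Rightarrow> real \<Rightarrow> real \<Rightarrow> bool"
  where "weighted_bound_holds _ s \<alpha> p \<longleftrightarrow>
    (\<exists>C::real. C > 0 \<and>
      (\<forall>y>0. \<forall>u :: real ^ 'n \<Rightarrow> real.
        u \<in> borel_measurable lebesgue \<longrightarrow> weighted_integral \<alpha> p y u < \<infinity> \<longrightarrow>
          (AE x in lebesgue. integrable lebesgue (harmonic_ext_integrand s u x y)) \<and>
          weighted_integral \<alpha> p y (\<lambda>x. harmonic_ext s u x y)
            \<le> ennreal C * weighted_integral \<alpha> p y u))"

end

theory Submission
  imports Defs
begin

text \<open>
  Write \<open>q y x = (norm x)\<^sup>2 + y\<^sup>2\<close>, \<open>m = n / 2 + s\<close>, and \<open>K z = y powr (2 * s) * q y z powr - m\<close>, so that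
  up to a constant the extension of \<open>u\<close> at height \<open>y\<close> is the convolution of \<open>u\<close> with \<open>K\<close>, and
  the weight in both integrals is \<open>q y powr - \<alpha>\<close>.

  Everything positive rests on one fact (\<open>nn_integral_ext_kernel_weight_le\<close>): convolution with \<open>K\<close>
  maps the power \<open>q y powr b\<close> to at most a constant times itself, uniformly in \<open>y\<close>, for
  \<open>- m \<le> b < s\<close>. Both limits are natural: \<open>K\<close> itself decays like \<open>q y powr - m\<close>, so a convolution
  cannot decay faster, and for \<open>b \<ge> s\<close> the integral diverges.

  The inequality then follows by a Schur test with a power as test function. Splitting
  \<open>u = (u / q y powr b) * q y powr b\<close> inside the integral and estimating as in Hoelder's inequality,
  the \<open>p\<close>-th power of \<open>K * \<bar>u\<bar>\<close> at \<open>x\<close> is at most a constant times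
  \<open>q y x powr (b * (p - 1))\<close> times the value at \<open>x\<close> of the convolution of \<open>K\<close> with
  \<open>\<bar>u\<bar> powr p * q y powr (b * (1 - p))\<close>. Multiplying by the weight, integrating, and exchanging the
  integrals leaves the convolution of \<open>K\<close> with \<open>q y powr (b * (p - 1) - \<alpha>)\<close>, to which the same
  fact applies. This asks for \<open>0 \<le> b < s\<close> and \<open>\<alpha> \<le> m + b * (p - 1)\<close>; the upper limit
  on \<open>b * (p - 1) - \<alpha>\<close> holds when \<open>b\<close> is taken as small as possible. For \<open>p = 1\<close> that is
  \<open>\<alpha> \<le> n / 2 + s\<close>, endpoint included; for \<open>p > 1\<close> the supremum \<open>n / 2 + s * p\<close> of the
  right-hand sides is not attained, because \<open>b\<close> stays below \<open>s\<close>.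

  Conversely, from the critical exponent on even the absolute convergence fails. The function
  \<open>norm z powr (2 * s) / (1 + log 2 (norm z))\<close> outside the unit ball, multiplied by the kernel, behaves
  like \<open>norm z powr - n / log (norm z)\<close>, whose dyadic shells contribute a harmonic series
  (\<open>divergent_datum_extension_infinite\<close>). Its weighted \<open>p\<close>-norm at \<open>\<alpha> = n / 2 + s * p\<close> gives the
  series of \<open>k powr - p\<close> instead, which converges exactly for \<open>p > 1\<close>; for larger \<open>\<alpha>\<close> there is geometric decay
  and \<open>p = 1\<close> is covered too (\<open>divergent_datum_weighted_finite\<close>).
\<close>

section \<open>The kernel and the weight\<close>

definition half_space_norm_sq :: "real \<Rightarrow> 'a::euclidean_space \<Rightarrow> real"
  where "half_space_norm_sq y x = (norm x)\<^sup>2 + y\<^sup>2"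

text \<open>
  The kernel of the extension at height \<open>y\<close> without its normalising constant, as a function of the
  difference \<open>x - \<xi>\<close>.
\<close>

definition ext_kernel :: "real \<Rightarrow> real \<Rightarrow> 'a::euclidean_space \<Rightarrow> real"
  where "ext_kernel s y z =
    y powr (2 * s) * half_space_norm_sq y z powr - (real DIM('a) / 2 + s)"

lemma half_space_norm_sq_ge: "y\<^sup>2 \<le> half_space_norm_sq y x"
  by (simp add: half_space_norm_sq_def)

lemma half_space_norm_sq_pos: "0 < y \<Longrightarrow> 0 < half_space_norm_sq y x"
  by (simp add: half_space_norm_sq_def add_nonneg_pos)

lemma half_space_norm_sq_minus_commute: "half_space_norm_sq y (x - z) = half_space_norm_sq y (z - x)"
  by (simp add: half_space_norm_sq_def norm_minus_commute)

text \<open>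
  Of the two quantities on the right, at least one is \<open>\<ge> half_space_norm_sq y x / 4\<close>; this is how a
  convolution is split into the part near the centre of the kernel and the part far from it.
\<close>

lemma half_space_norm_sq_triangle: "half_space_norm_sq y x \<le> 2 * half_space_norm_sq y z + 2 * half_space_norm_sq y (x - z)"
proof -
  have "norm x \<le> norm z + norm (x - z)"
    using norm_triangle_ineq[of z "x - z"] by simp
  then have "(norm x)\<^sup>2 \<le> (norm z + norm (x - z))\<^sup>2"
    by (intro power_mono) auto
  also have "\<dots> \<le> 2 * (norm z)\<^sup>2 + 2 * (norm (x - z))\<^sup>2"
    using sum_squares_bound[of "norm z" "norm (x - z)"] by (simp add: power2_sum)
  finally show ?thesis
    unfolding half_space_norm_sq_def distrib_left using zero_le_power2[of y] by linarith
qed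

lemma ext_kernel_nonneg: "0 \<le> ext_kernel s y z"
  by (simp add: ext_kernel_def)

lemma ext_kernel_minus_commute: "ext_kernel s y (x - z) = ext_kernel s y (z - x)"
  by (simp add: ext_kernel_def half_space_norm_sq_minus_commute[of y x z])

lemma borel_measurable_half_space_norm_sq [measurable]: "half_space_norm_sq y \<in> borel_measurable borel"
  unfolding half_space_norm_sq_def[abs_def] by measurable

lemma borel_measurable_ext_kernel [measurable]: "ext_kernel s y \<in> borel_measurable borel"
  unfolding ext_kernel_def[abs_def] by measurable

lemma id_measurable_lebesgue [measurable]:
  "(\<lambda>x::'a::euclidean_space. x) \<in> lebesgue \<rightarrow>\<^sub>M borel"
  by (rule measurable_completion) simp

lemma sigma_finite_lebesgue:
  "sigma_finite_measure (lebesgue :: 'a::euclidean_space measure)"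
proof
  show "\<exists>A::'a set set. countable A \<and> A \<subseteq> sets lebesgue \<and> \<Union>A = space lebesgue \<and>
    (\<forall>a\<in>A. emeasure lebesgue a \<noteq> \<infinity>)"
  proof (intro exI[of _ "range (\<lambda>n::nat. ball 0 (real n))"] conjI ballI)
    show "\<Union>(range (\<lambda>n::nat. ball 0 (real n))) = space (lebesgue :: 'a measure)"
      by (auto simp: reals_Archimedean2)
    fix a :: "'a set" assume "a \<in> range (\<lambda>n::nat. ball 0 (real n))"
    then show "emeasure lebesgue a \<noteq> \<infinity>"
      by (auto simp: emeasure_ball)
  qed auto
qed

section \<open>Integrals over dyadic shells\<close>

text \<open>
  The innermost ball counts as shell \<open>0\<close>. Shells are enlarged to the balls containing them: for the
  geometric bounds used below this costs only a constant factor. Centring the shells at an arbitrary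
  \<open>x\<close> makes the bound directly applicable to convolutions.
\<close>

lemma nn_integral_le_dyadic_sum:
  fixes f :: "'a::euclidean_space \<Rightarrow> ennreal" and c :: "nat \<Rightarrow> real"
  assumes r: "0 < r" and c: "\<And>k. 0 \<le> c k"
    and f: "\<And>k z. norm (x - z) < 2 ^ k * r \<Longrightarrow>
      k = 0 \<or> 2 ^ (k - 1) * r \<le> norm (x - z) \<Longrightarrow> f z \<le> ennreal (c k)"
  shows "(\<integral>\<^sup>+ z. f z \<partial>lebesgue)
    \<le> (\<Sum>k. ennreal (c k * (unit_ball_vol (real DIM('a)) * (2 ^ k * r) ^ DIM('a))))"
proof -
  let ?B = "\<lambda>k::nat. ball x (2 ^ k * r)"
  have [measurable]: "?B k \<in> sets lebesgue" for k
    by auto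
  have *: "f z \<le> (\<Sum>k. ennreal (c k) * indicator (?B k) z)" for z
  proof -
    obtain n where n: "norm (x - z) / r < 2 ^ n"
      using real_arch_pow[of 2] by auto
    define k where "k = (LEAST k. norm (x - z) < 2 ^ k * r)"
    have ex: "norm (x - z) < 2 ^ n * r"
      using n r by (simp add: field_simps)
    have k: "norm (x - z) < 2 ^ k * r"
      unfolding k_def by (rule LeastI[of "\<lambda>k. norm (x - z) < 2 ^ k * r", OF ex])
    have "k = 0 \<or> 2 ^ (k - 1) * r \<le> norm (x - z)"
      using not_less_Least[of "k - 1" "\<lambda>k. norm (x - z) < 2 ^ k * r"]
      unfolding k_def[symmetric] by fastforce
    then have "f z \<le> ennreal (c k)"
      using f k by blast
    also have "\<dots> = ennreal (c k) * indicator (?B k) z"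
      using k by (simp add: dist_norm)
    also have "\<dots> \<le> (\<Sum>k. ennreal (c k) * indicator (?B k) z)"
    proof -
      define g where "g j = ennreal (c j) * indicator (?B j) z" for j
      have "g k \<le> (\<Sum>j. g j)"
        using sum_le_suminf[of g "{k}"] by simp
      then show ?thesis by (simp add: g_def)
    qed
    finally show ?thesis .
  qed
  have "(\<integral>\<^sup>+ z. f z \<partial>lebesgue)
      \<le> (\<integral>\<^sup>+ z. (\<Sum>k. ennreal (c k) * indicator (?B k) z) \<partial>lebesgue)"
    by (intro nn_integral_mono *)
  also have "\<dots> = (\<Sum>k. \<integral>\<^sup>+ z. ennreal (c k) * indicator (?B k) z \<partial>lebesgue)"
    by (intro nn_integral_suminf) measurable
  also have "\<dots> = (\<Sum>k. ennreal (c k * (unit_ball_vol (real DIM('a)) * (2 ^ k * r) ^ DIM('a))))"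
    using r c by (simp add: nn_integral_cmult_indicator emeasure_ball ennreal_mult')
  finally show ?thesis .
qed

text \<open>
  A lower bound needs the shells themselves, which are disjoint. A shell with inner radius \<open>r\<close> and outer radius \<open>2 * r\<close>
  has at least the volume of the ball of radius \<open>r\<close>, since doubling the radius at least doubles the
  volume.
\<close>

lemma nn_integral_ge_dyadic_sum:
  fixes f :: "'a::euclidean_space \<Rightarrow> ennreal" and c :: "nat \<Rightarrow> real"
  assumes c: "\<And>k. 0 \<le> c k"
    and f: "\<And>k z. 2 ^ k \<le> norm z \<Longrightarrow> norm z < 2 ^ Suc k \<Longrightarrow> ennreal (c k) \<le> f z"
  shows "(\<Sum>k. ennreal (c k * (unit_ball_vol (real DIM('a)) * (2 ^ k) ^ DIM('a))))
    \<le> (\<integral>\<^sup>+ z. f z \<partial>lebesgue)"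
proof -
  define S where "S k = ball (0::'a) (2 ^ Suc k) - ball 0 (2 ^ k)" for k :: nat
  have S_iff: "z \<in> S k \<longleftrightarrow> 2 ^ k \<le> norm z \<and> norm z < 2 ^ Suc k" for z k
    by (auto simp: S_def)
  have S_meas [measurable]: "S k \<in> sets lebesgue" for k
    unfolding S_def by auto
  have S_unique: "j = k" if "z \<in> S j" "z \<in> S k" for z j k
  proof (rule ccontr)
    have no: False if "z \<in> S i" "z \<in> S l" "i < l" for i l
    proof -
      have "(2::real) ^ Suc i \<le> 2 ^ l"
        using that(3) by (intro power_increasing) auto
      with that(1,2) show False by (simp add: S_iff)
    qed
    assume "j \<noteq> k"
    then show False using no that by (metis linorder_neqE_nat)
  qed
  have S_vol: "ennreal (unit_ball_vol (real DIM('a)) * (2 ^ k) ^ DIM('a)) \<le> emeasure lebesgue (S k)" for k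
  proof -
    let ?V = "unit_ball_vol (real DIM('a))"
    have "(2::real) ^ 1 \<le> 2 ^ DIM('a)"
      by (intro power_increasing) (auto simp: Suc_leI)
    then have "2 * (2 ^ k) ^ DIM('a) \<le> (2 ^ Suc k :: real) ^ DIM('a)"
      by (simp add: power_mult_distrib)
    then have "?V * (2 ^ k) ^ DIM('a) \<le> ?V * ((2 ^ Suc k) ^ DIM('a) - (2 ^ k) ^ DIM('a))"
      by (intro mult_left_mono) auto
    also have "ball (0::'a) (2 ^ k) \<subseteq> ball 0 (2 ^ Suc k)"
      by (intro subset_ball) simp
    then have "ennreal (?V * ((2 ^ Suc k) ^ DIM('a) - (2 ^ k) ^ DIM('a))) = emeasure lebesgue (S k)"
      unfolding S_def
      by (subst emeasure_Diff)
        (auto simp: emeasure_ball right_diff_distrib ennreal_minus simp del: power_Suc)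
    finally show ?thesis
      using ennreal_leI by fastforce
  qed
  have *: "(\<Sum>k. ennreal (c k) * indicator (S k) z) \<le> f z" for z
  proof (cases "\<exists>j. z \<in> S j")
    case True
    then obtain j where j: "z \<in> S j" by blast
    have "(\<Sum>k. ennreal (c k) * indicator (S k) z) = (\<Sum>k\<in>{j}. ennreal (c k) * indicator (S k) z)"
      using S_unique[OF j] by (intro suminf_finite) (auto simp: indicator_def)
    also have "\<dots> \<le> f z"
      using j f by (simp add: S_iff)
    finally show ?thesis .
  qed simp
  have "(\<Sum>k. ennreal (c k * (unit_ball_vol (real DIM('a)) * (2 ^ k) ^ DIM('a))))
      \<le> (\<Sum>k. ennreal (c k) * emeasure lebesgue (S k))"
    using S_vol c by (intro suminf_le) (auto simp: ennreal_mult' intro: mult_left_mono)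
  also have "\<dots> = (\<Sum>k. \<integral>\<^sup>+ z. ennreal (c k) * indicator (S k) z \<partial>lebesgue)"
    by (simp add: nn_integral_cmult_indicator)
  also have "\<dots> = (\<integral>\<^sup>+ z. (\<Sum>k. ennreal (c k) * indicator (S k) z) \<partial>lebesgue)"
    by (intro nn_integral_suminf[symmetric]) auto
  also have "\<dots> \<le> (\<integral>\<^sup>+ z. f z \<partial>lebesgue)"
    by (intro nn_integral_mono *)
  finally show ?thesis .
qed

text \<open>
  On the shell of radius \<open>2 ^ k * y\<close> the integrand is comparable to \<open>(2 ^ k * y) powr (- 2 * a)\<close> and
  the volume to \<open>(2 ^ k * y) ^ n\<close>, so the bound is a geometric series of ratio
  \<open>2 powr (n - 2 * a) < 1\<close>. The power of \<open>y\<close> is the one dictated by scaling; it makes all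
  constants below independent of \<open>y\<close>.
\<close>

lemma nn_integral_half_space_norm_sq_powr_le:
  assumes a: "real DIM('a) / 2 < a"
  shows "\<exists>C>0. \<forall>y>0. \<forall>x::'a::euclidean_space.
    (\<integral>\<^sup>+ z. ennreal (half_space_norm_sq y (x - z) powr - a) \<partial>lebesgue)
      \<le> ennreal (C * y powr (real DIM('a) - 2 * a))"
proof -
  let ?n = "real DIM('a)" let ?V = "unit_ball_vol (real DIM('a))"
  define g where "g = 2 powr (?n - 2 * a)"
  have g: "0 < g" "g < 1"
    using a by (auto simp: g_def powr_less_one)
  define C where "C = ?V * 4 powr a / (1 - g)"
  have "0 < C" using g by (simp add: C_def)
  moreover have "(\<integral>\<^sup>+ z. ennreal (half_space_norm_sq y (x - z) powr - a) \<partial>lebesgue)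
      \<le> ennreal (C * y powr (?n - 2 * a))" if y: "0 < y" for y and x :: 'a
  proof -
    define c where "c k = (2 ^ k * y / 2) powr (- 2 * a)" for k :: nat
    have "(\<integral>\<^sup>+ z. ennreal (half_space_norm_sq y (x - z) powr - a) \<partial>lebesgue)
        \<le> (\<Sum>k. ennreal (c k * (?V * (2 ^ k * y) ^ DIM('a))))"
    proof (rule nn_integral_le_dyadic_sum[OF y, of c x])
      fix k :: nat and z
      assume k: "k = 0 \<or> 2 ^ (k - 1) * y \<le> norm (x - z)"
      \<comment> \<open>Half the outer radius: from the norm on a genuine shell, and from \<open>y\<close> itself on the innermost ball.\<close>
      have "(2 ^ k * y / 2)\<^sup>2 \<le> half_space_norm_sq y (x - z)"
      proof (cases "k = 0")
        case True
        then have "(2 ^ k * y / 2)\<^sup>2 \<le> y\<^sup>2"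
          using y by (intro power_mono) auto
        then show ?thesis using half_space_norm_sq_ge[of y "x - z"] by linarith
      next
        case False
        then obtain l where l: "k = Suc l" by (cases k) auto
        with k have "(2 ^ k * y / 2)\<^sup>2 \<le> (norm (x - z))\<^sup>2"
          using y by (intro power_mono) auto
        then show ?thesis unfolding half_space_norm_sq_def by (simp add: add_increasing2)
      qed
      then have "half_space_norm_sq y (x - z) powr - a \<le> ((2 ^ k * y / 2)\<^sup>2) powr - a"
        using a y by (intro powr_mono2') auto
      also have "\<dots> = c k"
        unfolding c_def using y by (simp add: powr_powr powr_numeral[symmetric] del: powr_numeral)
      finally show "ennreal (half_space_norm_sq y (x - z) powr - a) \<le> ennreal (c k)"
        by (rule ennreal_leI)
    qed (auto simp: c_def)
    also have "(\<lambda>k. c k * (?V * (2 ^ k * y) ^ DIM('a)))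
        = (\<lambda>k. ?V * 4 powr a * y powr (?n - 2 * a) * g ^ k)"
    proof
      fix k :: nat
      have "c k = (2 ^ k) powr (- 2 * a) * y powr (- 2 * a) * 4 powr a"
      proof -
        have "(1 / 2) powr (- 2 * a) = (4::real) powr a"
          by (simp add: powr_divide powr_minus powr_powr[symmetric])
        moreover have "c k = (2 ^ k * y * (1 / 2)) powr (- 2 * a)"
          by (simp add: c_def)
        ultimately show ?thesis
          using y by (simp only: powr_mult)
      qed
      moreover have "(2 ^ k * y) ^ DIM('a) = (2 ^ k) powr ?n * y powr ?n"
        using y by (simp add: powr_realpow power_mult_distrib)
      moreover have "(2 ^ k) powr (- 2 * a) * (2 ^ k) powr ?n = g ^ k"
        by (simp add: g_def powr_add[symmetric] powr_realpow[symmetric] powr_powr algebra_simps)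
      moreover have "y powr (- 2 * a) * y powr ?n = y powr (?n - 2 * a)"
        by (simp add: powr_add[symmetric])
      ultimately show "c k * (?V * (2 ^ k * y) ^ DIM('a)) = ?V * 4 powr a * y powr (?n - 2 * a) * g ^ k"
        by (smt (verit, ccfv_threshold) mult.assoc mult.commute)
    qed
    also have "(\<Sum>k. ennreal (?V * 4 powr a * y powr (?n - 2 * a) * g ^ k))
        = ennreal (\<Sum>k. ?V * 4 powr a * y powr (?n - 2 * a) * g ^ k)"
      using g by (intro suminf_ennreal2 summable_mult summable_geometric) auto
    also have "(\<Sum>k. ?V * 4 powr a * y powr (?n - 2 * a) * g ^ k) = C * y powr (?n - 2 * a)"
      using g by (simp add: suminf_mult suminf_geometric summable_geometric C_def)
    finally show ?thesis .
  qed
  ultimately show ?thesis by blast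
qed


section \<open>The kernel acting on powers of the weight\<close>

lemma nn_integral_ext_kernel_le:
  assumes s: "0 < s"
  shows "\<exists>C>0. \<forall>y>0. \<forall>x::'a::euclidean_space.
    (\<integral>\<^sup>+ z. ennreal (ext_kernel s y (x - z)) \<partial>lebesgue) \<le> ennreal C"
proof -
  let ?m = "real DIM('a) / 2 + s"
  obtain C where C: "C > 0" and *: "\<And>y x::'a. y > 0 \<Longrightarrow>
      (\<integral>\<^sup>+ z. ennreal (half_space_norm_sq y (x - z) powr - ?m) \<partial>lebesgue)
        \<le> ennreal (C * y powr (real DIM('a) - 2 * ?m))"
    using nn_integral_half_space_norm_sq_powr_le[of ?m, where ?'a = 'a] s by auto
  have "(\<integral>\<^sup>+ z. ennreal (ext_kernel s y (x - z)) \<partial>lebesgue) \<le> ennreal C"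
    if y: "0 < y" for y and x :: 'a
  proof -
    have "(\<integral>\<^sup>+ z. ennreal (ext_kernel s y (x - z)) \<partial>lebesgue)
        = ennreal (y powr (2 * s)) * (\<integral>\<^sup>+ z. ennreal (half_space_norm_sq y (x - z) powr - ?m) \<partial>lebesgue)"
      unfolding ext_kernel_def by (subst nn_integral_cmult[symmetric]) (auto simp: ennreal_mult')
    also have "\<dots> \<le> ennreal (y powr (2 * s)) * ennreal (C * y powr (real DIM('a) - 2 * ?m))"
      by (intro mult_left_mono * y) auto
    also have "\<dots> = ennreal C"
      using C y by (simp add: ennreal_mult'[symmetric] powr_add[symmetric] mult.left_commute)
    finally show ?thesis .
  qed
  with C show ?thesis by blast
qed

text \<open>
  A growing weight at \<open>z\<close> is, up to a constant, at most its value at \<open>x\<close> plus its value at \<open>x - z\<close>. The second part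
  leaves the integral of \<open>y powr (2 * s) * q powr (b - m)\<close> with \<open>m = n / 2 + s\<close>, finite because \<open>b < s\<close>, and of size
  \<open>y powr (2 * b) \<le> q y x powr b\<close>.
\<close>

lemma nn_integral_ext_kernel_weight_le_nonneg:
  assumes s: "0 < s" and b: "0 \<le> b" "b < s"
  shows "\<exists>C>0. \<forall>y>0. \<forall>x::'a::euclidean_space.
    (\<integral>\<^sup>+ z. ennreal (ext_kernel s y (x - z) * half_space_norm_sq y z powr b) \<partial>lebesgue)
      \<le> ennreal (C * half_space_norm_sq y x powr b)"
proof -
  let ?m = "real DIM('a) / 2 + s" let ?q = "half_space_norm_sq :: real \<Rightarrow> 'a \<Rightarrow> real"
  obtain C1 where C1: "C1 > 0" and K: "\<And>y x::'a. y > 0 \<Longrightarrow>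
      (\<integral>\<^sup>+ z. ennreal (ext_kernel s y (x - z)) \<partial>lebesgue) \<le> ennreal C1"
    using nn_integral_ext_kernel_le[OF s, where ?'a = 'a] by auto
  obtain C2 where C2: "C2 > 0" and Q: "\<And>y x::'a. y > 0 \<Longrightarrow>
      (\<integral>\<^sup>+ z. ennreal (half_space_norm_sq y (x - z) powr - (?m - b)) \<partial>lebesgue)
        \<le> ennreal (C2 * y powr (real DIM('a) - 2 * (?m - b)))"
    using nn_integral_half_space_norm_sq_powr_le[of "?m - b", where ?'a = 'a] b by auto
  define C where "C = 4 powr b * (C1 + C2)"
  have "(\<integral>\<^sup>+ z. ennreal (ext_kernel s y (x - z) * ?q y z powr b) \<partial>lebesgue)
      \<le> ennreal (C * ?q y x powr b)" if y: "0 < y" for y and x :: 'a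
  proof -
    note pos = half_space_norm_sq_pos[OF y]
    have "ext_kernel s y (x - z) * ?q y z powr b
        \<le> 4 powr b * ?q y x powr b * ext_kernel s y (x - z)
          + 4 powr b * y powr (2 * s) * ?q y (x - z) powr - (?m - b)" for z
    proof -
      have "?q y z \<le> 4 * max (?q y x) (?q y (x - z))"
        using half_space_norm_sq_triangle[of y z x] half_space_norm_sq_minus_commute[of y z x] by linarith
      then have "?q y z powr b \<le> (4 * max (?q y x) (?q y (x - z))) powr b"
        using b pos[of z] by (intro powr_mono2) (auto intro: less_imp_le)
      also have "\<dots> = 4 powr b * max (?q y x) (?q y (x - z)) powr b"
        using pos[of x] by (simp add: powr_mult)
      also have "\<dots> \<le> 4 powr b * (?q y x powr b + ?q y (x - z) powr b)"
        by (intro mult_left_mono) (auto simp: max_def)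
      finally have "ext_kernel s y (x - z) * ?q y z powr b
          \<le> ext_kernel s y (x - z) * (4 powr b * (?q y x powr b + ?q y (x - z) powr b))"
        by (intro mult_left_mono ext_kernel_nonneg)
      also have "?q y (x - z) powr - (?m - b) = ?q y (x - z) powr - ?m * ?q y (x - z) powr b"
        by (simp add: powr_add[symmetric] algebra_simps)
      then have "ext_kernel s y (x - z) * (4 powr b * (?q y x powr b + ?q y (x - z) powr b))
        = 4 powr b * ?q y x powr b * ext_kernel s y (x - z)
          + 4 powr b * y powr (2 * s) * ?q y (x - z) powr - (?m - b)"
        by (simp only: ext_kernel_def) (simp only: algebra_simps)
      finally show ?thesis .
    qed
    then have "(\<integral>\<^sup>+ z. ennreal (ext_kernel s y (x - z) * ?q y z powr b) \<partial>lebesgue)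
        \<le> (\<integral>\<^sup>+ z. ennreal (4 powr b * ?q y x powr b) * ennreal (ext_kernel s y (x - z))
          + ennreal (4 powr b * y powr (2 * s)) * ennreal (?q y (x - z) powr - (?m - b)) \<partial>lebesgue)"
      by (intro nn_integral_mono)
        (simp add: ennreal_mult'[symmetric] ennreal_plus[symmetric] ext_kernel_nonneg ennreal_leI del: ennreal_plus)
    also have "\<dots> = ennreal (4 powr b * ?q y x powr b) * (\<integral>\<^sup>+ z. ennreal (ext_kernel s y (x - z)) \<partial>lebesgue)
          + ennreal (4 powr b * y powr (2 * s)) * (\<integral>\<^sup>+ z. ennreal (?q y (x - z) powr - (?m - b)) \<partial>lebesgue)"
      by (simp add: nn_integral_add nn_integral_cmult)
    also have "\<dots> \<le> ennreal (4 powr b * ?q y x powr b) * ennreal C1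
          + ennreal (4 powr b * y powr (2 * s)) * ennreal (C2 * y powr (real DIM('a) - 2 * (?m - b)))"
      by (intro add_mono mult_left_mono K Q y) auto
    also have "\<dots> = ennreal (4 powr b * ?q y x powr b * C1
          + 4 powr b * C2 * (y powr (2 * s) * y powr (real DIM('a) - 2 * (?m - b))))"
      using C1 C2 by (simp add: ennreal_mult'[symmetric] ennreal_plus[symmetric] mult_ac del: ennreal_plus)
    also have "y powr (2 * s) * y powr (real DIM('a) - 2 * (?m - b)) = (y\<^sup>2) powr b"
      using y by (simp add: powr_add[symmetric] powr_powr powr_numeral[symmetric] del: powr_numeral)
    also have "4 powr b * ?q y x powr b * C1 + 4 powr b * C2 * (y\<^sup>2) powr b
        \<le> 4 powr b * ?q y x powr b * C1 + 4 powr b * C2 * ?q y x powr b"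
      using C2 b half_space_norm_sq_ge[of y x] by (intro add_left_mono mult_left_mono powr_mono2) auto
    also have "\<dots> = C * ?q y x powr b"
      by (simp add: C_def algebra_simps)
    finally show ?thesis by (simp add: ennreal_leI)
  qed
  moreover have "C > 0" using C1 C2 by (simp add: C_def)
  ultimately show ?thesis by blast
qed

text \<open>
  With a decaying weight, \<open>z\<close> is either so far out that the weight at \<open>z\<close> is comparable to the weight at
  \<open>x\<close>, or \<open>x - z\<close> is so large that the kernel is comparable to its value at \<open>x\<close>. In the second case
  \<open>q y x powr - m = q y x powr b * q y x powr - (m + b)\<close>, and since \<open>m + b \<ge> 0\<close> and \<open>q y z \<le> q y x\<close> the excess
  can be moved from \<open>x\<close> to \<open>z\<close>, where it completes the weight to the kernel centred at \<open>0\<close>. So in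
  both cases the integrand is at most a constant times the weight at \<open>x\<close> times one of two kernels of
  bounded mass.
\<close>

lemma nn_integral_ext_kernel_weight_le_neg:
  assumes s: "0 < s" and b: "- (real DIM('a) / 2 + s) \<le> b" "b < 0"
  shows "\<exists>C>0. \<forall>y>0. \<forall>x::'a::euclidean_space.
    (\<integral>\<^sup>+ z. ennreal (ext_kernel s y (x - z) * half_space_norm_sq y z powr b) \<partial>lebesgue)
      \<le> ennreal (C * half_space_norm_sq y x powr b)"
proof -
  let ?m = "real DIM('a) / 2 + s" let ?q = "half_space_norm_sq :: real \<Rightarrow> 'a \<Rightarrow> real"
  obtain C1 where C1: "C1 > 0" and K: "\<And>y x::'a. y > 0 \<Longrightarrow>
      (\<integral>\<^sup>+ z. ennreal (ext_kernel s y (x - z)) \<partial>lebesgue) \<le> ennreal C1"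
    using nn_integral_ext_kernel_le[OF s, where ?'a = 'a] by auto
  define C where "C = 4 powr ?m * (C1 + C1)"
  have "(\<integral>\<^sup>+ z. ennreal (ext_kernel s y (x - z) * ?q y z powr b) \<partial>lebesgue)
      \<le> ennreal (C * ?q y x powr b)" if y: "0 < y" for y and x :: 'a
  proof -
    note pos = half_space_norm_sq_pos[OF y]
    have quarter: "(1 / 4) powr e = (4::real) powr - e" for e
      by (simp add: powr_divide powr_minus inverse_eq_divide)
    have "ext_kernel s y (x - z) * ?q y z powr b
        \<le> 4 powr ?m * ?q y x powr b * (ext_kernel s y (x - z) + ext_kernel s y (0 - z))" for z
    proof (cases "?q y x \<le> 4 * ?q y z")
      case True
      then have "?q y z powr b \<le> (?q y x * (1 / 4)) powr b"
        using b pos[of x] by (intro powr_mono2') auto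
      also have "\<dots> = ?q y x powr b * 4 powr (- b)"
        using pos[of x] quarter by (simp add: powr_mult add.commute del: times_divide_eq_right)
      also have "\<dots> \<le> ?q y x powr b * 4 powr ?m"
        using b by (intro mult_left_mono powr_mono) auto
      finally have "?q y z powr b \<le> 4 powr ?m * ?q y x powr b"
        by (simp only: mult.commute)
      then have "ext_kernel s y (x - z) * ?q y z powr b
          \<le> ext_kernel s y (x - z) * (4 powr ?m * ?q y x powr b)"
        by (intro mult_left_mono ext_kernel_nonneg)
      also have "\<dots> \<le> 4 powr ?m * ?q y x powr b * (ext_kernel s y (x - z) + ext_kernel s y (0 - z))"
        by (simp add: distrib_left ext_kernel_nonneg)
      finally show ?thesis .
    next
      case False
      then have "?q y x * (1 / 4) \<le> ?q y (x - z)"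
        using half_space_norm_sq_triangle[of y x z] by linarith
      then have "?q y (x - z) powr - ?m \<le> (?q y x * (1 / 4)) powr - ?m"
        using s pos[of x] by (intro powr_mono2') auto
      also have "\<dots> = 4 powr ?m * ?q y x powr - ?m"
        using pos[of x] quarter by (simp add: powr_mult add.commute del: times_divide_eq_right)
      also have "\<dots> = 4 powr ?m * (?q y x powr b * ?q y x powr - (?m + b))"
        by (simp add: powr_add[symmetric])
      also have "\<dots> \<le> 4 powr ?m * (?q y x powr b * ?q y z powr - (?m + b))"
        using b False pos[of z] by (intro mult_left_mono powr_mono2') auto
      finally have "?q y (x - z) powr - ?m * ?q y z powr b
          \<le> 4 powr ?m * (?q y x powr b * ?q y z powr - (?m + b)) * ?q y z powr b"
        by (intro mult_right_mono) auto
      also have "\<dots> = 4 powr ?m * ?q y x powr b * (?q y z powr - (?m + b) * ?q y z powr b)"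
        by simp
      also have "?q y z powr - (?m + b) * ?q y z powr b = ?q y z powr - ?m"
        by (simp add: powr_add[symmetric])
      finally have "y powr (2 * s) * (?q y (x - z) powr - ?m * ?q y z powr b)
          \<le> y powr (2 * s) * (4 powr ?m * ?q y x powr b * ?q y z powr - ?m)"
        by (intro mult_left_mono) auto
      then have "ext_kernel s y (x - z) * ?q y z powr b
          \<le> 4 powr ?m * ?q y x powr b * ext_kernel s y (0 - z)"
        unfolding ext_kernel_minus_commute[of s y 0 z] by (simp add: ext_kernel_def mult_ac)
      also have "\<dots> \<le> 4 powr ?m * ?q y x powr b * (ext_kernel s y (x - z) + ext_kernel s y (0 - z))"
        by (simp add: distrib_left ext_kernel_nonneg)
      finally show ?thesis .
    qed
    then have "(\<integral>\<^sup>+ z. ennreal (ext_kernel s y (x - z) * ?q y z powr b) \<partial>lebesgue)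
        \<le> (\<integral>\<^sup>+ z. ennreal (4 powr ?m * ?q y x powr b)
            * (ennreal (ext_kernel s y (x - z)) + ennreal (ext_kernel s y (0 - z))) \<partial>lebesgue)"
      by (intro nn_integral_mono)
        (simp add: ennreal_mult'[symmetric] ennreal_plus[symmetric] ext_kernel_nonneg ennreal_leI
          del: ennreal_plus diff_0)
    also have "\<dots> = ennreal (4 powr ?m * ?q y x powr b) *
        ((\<integral>\<^sup>+ z. ennreal (ext_kernel s y (x - z)) \<partial>lebesgue)
          + (\<integral>\<^sup>+ z. ennreal (ext_kernel s y ((0::'a) - z)) \<partial>lebesgue))"
      by (simp add: nn_integral_add nn_integral_cmult)
    also have "\<dots> \<le> ennreal (4 powr ?m * ?q y x powr b) * (ennreal C1 + ennreal C1)"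
      by (intro add_mono mult_left_mono K y) auto
    also have "\<dots> = ennreal (C * ?q y x powr b)"
      using C1 by (simp add: C_def ennreal_mult'[symmetric] ennreal_plus[symmetric] mult_ac del: ennreal_plus)
    finally show ?thesis .
  qed
  moreover have "C > 0" using C1 by (simp add: C_def)
  ultimately show ?thesis by blast
qed

lemma nn_integral_ext_kernel_weight_le:
  assumes s: "0 < s" and b: "- (real DIM('a) / 2 + s) \<le> b" "b < s"
  shows "\<exists>C>0. \<forall>y>0. \<forall>x::'a::euclidean_space.
    (\<integral>\<^sup>+ z. ennreal (ext_kernel s y (x - z) * half_space_norm_sq y z powr b) \<partial>lebesgue)
      \<le> ennreal (C * half_space_norm_sq y x powr b)"
proof (cases "0 \<le> b")
  case True
  then show ?thesis using nn_integral_ext_kernel_weight_le_nonneg[OF s _ b(2)] by simp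
next
  case False
  then show ?thesis using nn_integral_ext_kernel_weight_le_neg[OF s b(1)] by simp
qed

section \<open>A weighted power inequality for integrals\<close>

lemma le_truncated_power:
  fixes t c p :: real
  assumes "0 \<le> t" "0 < c" "1 \<le> p"
  shows "t \<le> c + c powr (1 - p) * t powr p"
proof (cases "t \<le> c")
  case False
  then have "t = t powr (1 - p) * t powr p"
    using assms by (simp add: powr_add[symmetric])
  also have "\<dots> \<le> c powr (1 - p) * t powr p"
    using False assms by (intro mult_right_mono powr_mono2') auto
  finally show ?thesis using assms by simp
qed (use assms in \<open>simp add: add_increasing2\<close>)

text \<open>
  Hoelder's inequality for \<open>f / v\<close> with respect to the measure of density \<open>k * v\<close> and mass at most \<open>A\<close>,
  up to the factor \<open>2 powr p\<close>. Instead of conjugate exponents it uses \<open>t \<le> c + c powr (1 - p) * t powr p\<close>,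
  which integrates to \<open>T \<le> c * A + c powr (1 - p) * B\<close> for the integral \<open>T\<close> of \<open>k * f\<close>; the
  choice \<open>c = T / (2 * A)\<close> lets the left-hand side absorb half of itself. It treats \<open>p = 1\<close> and \<open>p > 1\<close> alike,
  and with \<open>c = 1\<close> it shows that \<open>T\<close> is finite in the first place.
\<close>

lemma nn_integral_powr_le_weighted:
  fixes k v f :: "'a \<Rightarrow> real"
  assumes [measurable]: "k \<in> borel_measurable M" "v \<in> borel_measurable M" "f \<in> borel_measurable M"
    and k: "\<And>x. 0 \<le> k x" and v: "\<And>x. 0 < v x" and f: "\<And>x. 0 \<le> f x"
    and p: "1 \<le> p" and A: "0 < A" and mass: "(\<integral>\<^sup>+ x. ennreal (k x * v x) \<partial>M) \<le> ennreal A"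
    and B: "(\<integral>\<^sup>+ x. ennreal (k x * (v x powr (1 - p) * f x powr p)) \<partial>M) = ennreal B" "0 \<le> B"
  shows "(\<integral>\<^sup>+ x. ennreal (k x * f x) \<partial>M) < \<infinity>"
    and "enn2real (\<integral>\<^sup>+ x. ennreal (k x * f x) \<partial>M) powr p \<le> 2 * (2 * A) powr (p - 1) * B"
proof -
  let ?N = "\<integral>\<^sup>+ x. ennreal (k x * f x) \<partial>M"
  have N_le: "?N \<le> ennreal (c * A + c powr (1 - p) * B)" if c: "0 < c" for c
  proof -
    have "k x * f x \<le> c * (k x * v x) + c powr (1 - p) * (k x * (v x powr (1 - p) * f x powr p))" for x
    proof -
      have "f x / v x \<le> c + c powr (1 - p) * (f x / v x) powr p"
        using v f c p by (intro le_truncated_power) (auto intro: divide_nonneg_pos)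
      then have "k x * v x * (f x / v x) \<le> k x * v x * (c + c powr (1 - p) * (f x / v x) powr p)"
        using k v[of x] by (intro mult_left_mono mult_nonneg_nonneg) auto
      moreover have "v x * (f x / v x) powr p = v x powr (1 - p) * f x powr p"
        using v[of x] f[of x] by (simp add: powr_divide powr_diff)
      moreover have "k x * v x * (f x / v x) = k x * f x"
        using v[of x] by simp
      moreover have "k x * v x * (c + c powr (1 - p) * (f x / v x) powr p)
          = c * (k x * v x) + c powr (1 - p) * (k x * (v x * (f x / v x) powr p))"
        by (simp only: algebra_simps)
      ultimately show ?thesis by simp
    qed
    then have "?N \<le> (\<integral>\<^sup>+ x. ennreal c * ennreal (k x * v x)
        + ennreal (c powr (1 - p)) * ennreal (k x * (v x powr (1 - p) * f x powr p)) \<partial>M)"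
      using c k v by (intro nn_integral_mono)
        (simp add: ennreal_mult'[symmetric] ennreal_plus[symmetric] ennreal_leI less_imp_le del: ennreal_plus)
    also have "\<dots> = ennreal c * (\<integral>\<^sup>+ x. ennreal (k x * v x) \<partial>M) + ennreal (c powr (1 - p)) * ennreal B"
      by (simp add: nn_integral_add nn_integral_cmult B(1))
    also have "\<dots> \<le> ennreal c * ennreal A + ennreal (c powr (1 - p)) * ennreal B"
      by (intro add_mono mult_left_mono mass) auto
    also have "\<dots> = ennreal (c * A + c powr (1 - p) * B)"
      using c A B(2) by (simp add: ennreal_mult'[symmetric] ennreal_plus[symmetric] del: ennreal_plus)
    finally show ?thesis .
  qed
  show fin: "?N < \<infinity>"
    using N_le[of 1] by (simp add: le_less_trans)
  define T where "T = enn2real ?N"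
  have T0: "0 \<le> T" by (simp add: T_def)
  have NT: "?N = ennreal T"
    using fin by (simp add: T_def)
  show "enn2real ?N powr p \<le> 2 * (2 * A) powr (p - 1) * B"
    unfolding T_def[symmetric]
  proof (cases "T = 0")
    case False
    with T0 have T: "0 < T" by simp
    \<comment> \<open>The value for which \<open>c * A\<close> is half of \<open>T\<close>.\<close>
    define c where "c = T / (2 * A)"
    have c: "0 < c" using T A by (simp add: c_def)
    have "T \<le> c * A + c powr (1 - p) * B"
      using N_le[OF c] c A B(2) unfolding NT by (subst (asm) ennreal_le_iff) auto
    also have "c * A = T / 2"
      using A by (simp add: c_def)
    finally have "T \<le> 2 * B * c powr (1 - p)" by (simp add: algebra_simps)
    then have "T * T powr (p - 1) \<le> 2 * B * c powr (1 - p) * T powr (p - 1)"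
      by (intro mult_right_mono) auto
    also have "T * T powr (p - 1) = T powr p"
      using T by (simp add: powr_diff)
    also have "c powr (1 - p) * T powr (p - 1) = (2 * A) powr (p - 1)"
      using T A unfolding c_def by (simp add: powr_divide powr_diff)
    then have "2 * B * c powr (1 - p) * T powr (p - 1) = 2 * (2 * A) powr (p - 1) * B"
      by (simp add: algebra_simps)
    finally show "T powr p \<le> 2 * (2 * A) powr (p - 1) * B" .
  qed (use A B in simp)
qed


section \<open>The inequality below the critical exponent\<close>

text \<open>
  The Schur test with the test function \<open>half_space_norm_sq y powr b\<close>. The kernel is applied to two
  powers of the weight: to the power \<open>b\<close> for the mass in the pointwise Hoelder estimate, and to the power
  \<open>b * (p - 1) - \<alpha>\<close> after the order of integration has been exchanged. The finite double integral
  also yields the absolute convergence almost everywhere.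
\<close>

lemma weighted_ext_kernel_bound:
  fixes \<alpha> b s p :: real
  assumes s: "0 < s" and p: "1 \<le> p" and b: "0 \<le> b" "b < s"
    and g: "- (real DIM('a) / 2 + s) \<le> b * (p - 1) - \<alpha>" "b * (p - 1) - \<alpha> < s"
  shows "\<exists>C>0. \<forall>y>0. \<forall>u::'a::euclidean_space \<Rightarrow> real.
    u \<in> borel_measurable lebesgue \<longrightarrow>
    (\<integral>\<^sup>+ z. ennreal (\<bar>u z\<bar> powr p * half_space_norm_sq y z powr - \<alpha>) \<partial>lebesgue) < \<infinity> \<longrightarrow>
    (AE x in lebesgue. (\<integral>\<^sup>+ z. ennreal (ext_kernel s y (x - z) * \<bar>u z\<bar>) \<partial>lebesgue) < \<infinity>) \<and>
    (\<integral>\<^sup>+ x. ennreal (enn2real (\<integral>\<^sup>+ z. ennreal (ext_kernel s y (x - z) * \<bar>u z\<bar>) \<partial>lebesgue) powr p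
        * half_space_norm_sq y x powr - \<alpha>) \<partial>lebesgue)
      \<le> ennreal C * (\<integral>\<^sup>+ z. ennreal (\<bar>u z\<bar> powr p * half_space_norm_sq y z powr - \<alpha>) \<partial>lebesgue)"
proof -
  let ?q = "half_space_norm_sq :: real \<Rightarrow> 'a \<Rightarrow> real"
  let ?g = "b * (p - 1) - \<alpha>"
  obtain C1 where C1: "C1 > 0" and mass: "\<And>y x::'a. y > 0 \<Longrightarrow>
      (\<integral>\<^sup>+ z. ennreal (ext_kernel s y (x - z) * ?q y z powr b) \<partial>lebesgue) \<le> ennreal (C1 * ?q y x powr b)"
    using nn_integral_ext_kernel_weight_le[OF s _ b(2), where ?'a = 'a] b s by auto
  obtain C2 where C2: "C2 > 0" and dual: "\<And>y x::'a. y > 0 \<Longrightarrow>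
      (\<integral>\<^sup>+ z. ennreal (ext_kernel s y (x - z) * ?q y z powr ?g) \<partial>lebesgue) \<le> ennreal (C2 * ?q y x powr ?g)"
    using nn_integral_ext_kernel_weight_le[OF s g] by auto
  interpret sigma_finite_measure "lebesgue :: 'a measure"
    by (rule sigma_finite_lebesgue)
  interpret pair_sigma_finite "lebesgue :: 'a measure" "lebesgue :: 'a measure" ..
  define D where "D = 2 * (2 * C1) powr (p - 1)"
  have D: "0 < D" using C1 by (simp add: D_def)
  have "(AE x in lebesgue. (\<integral>\<^sup>+ z. ennreal (ext_kernel s y (x - z) * \<bar>u z\<bar>) \<partial>lebesgue) < \<infinity>) \<and>
    (\<integral>\<^sup>+ x. ennreal (enn2real (\<integral>\<^sup>+ z. ennreal (ext_kernel s y (x - z) * \<bar>u z\<bar>) \<partial>lebesgue) powr p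
        * ?q y x powr - \<alpha>) \<partial>lebesgue)
      \<le> ennreal (D * C2) * (\<integral>\<^sup>+ z. ennreal (\<bar>u z\<bar> powr p * ?q y z powr - \<alpha>) \<partial>lebesgue)"
    if y: "0 < y" and u [measurable]: "u \<in> borel_measurable lebesgue"
      and fin: "(\<integral>\<^sup>+ z. ennreal (\<bar>u z\<bar> powr p * ?q y z powr - \<alpha>) \<partial>lebesgue) < \<infinity>" (is "?I < _")
    for y and u :: "'a \<Rightarrow> real"
  proof -
    note pos = half_space_norm_sq_pos[OF y]
    define h where "h z = (?q y z powr b) powr (1 - p) * \<bar>u z\<bar> powr p" for z
    have [measurable]: "h \<in> borel_measurable lebesgue"
      unfolding h_def[abs_def] by measurable
    have h0: "0 \<le> h z" for z by (simp add: h_def)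
    define B where "B x = (\<integral>\<^sup>+ z. ennreal (ext_kernel s y (x - z) * h z) \<partial>lebesgue)" for x
    have [measurable]: "B \<in> borel_measurable lebesgue"
      unfolding B_def[abs_def] by measurable
    let ?T = "\<lambda>x. \<integral>\<^sup>+ z. ennreal (ext_kernel s y (x - z) * \<bar>u z\<bar>) \<partial>lebesgue"
    have B_bound: "(\<integral>\<^sup>+ x. ennreal (?q y x powr ?g) * B x \<partial>lebesgue) \<le> ennreal C2 * ?I"
    proof -
      have "(\<integral>\<^sup>+ x. ennreal (?q y x powr ?g) * B x \<partial>lebesgue)
          = (\<integral>\<^sup>+ x. \<integral>\<^sup>+ z. ennreal (?q y x powr ?g) * ennreal (ext_kernel s y (x - z) * h z) \<partial>lebesgue \<partial>lebesgue)"
        unfolding B_def by (intro nn_integral_cong nn_integral_cmult[symmetric]) measurable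
      also have "\<dots> = (\<integral>\<^sup>+ z. \<integral>\<^sup>+ x. ennreal (?q y x powr ?g) * ennreal (ext_kernel s y (x - z) * h z) \<partial>lebesgue \<partial>lebesgue)"
        by (intro Fubini'[symmetric]) measurable
      also have "\<dots> = (\<integral>\<^sup>+ z. ennreal (h z) * (\<integral>\<^sup>+ x. ennreal (ext_kernel s y (z - x) * ?q y x powr ?g) \<partial>lebesgue) \<partial>lebesgue)"
      proof (intro nn_integral_cong)
        fix z :: 'a
        have "(\<integral>\<^sup>+ x. ennreal (?q y x powr ?g) * ennreal (ext_kernel s y (x - z) * h z) \<partial>lebesgue)
          = (\<integral>\<^sup>+ x. ennreal (h z) * ennreal (ext_kernel s y (z - x) * ?q y x powr ?g) \<partial>lebesgue)"
        proof (intro nn_integral_cong)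
          fix x :: 'a
          have "?q y x powr ?g * (ext_kernel s y (x - z) * h z) = h z * (ext_kernel s y (z - x) * ?q y x powr ?g)"
            by (simp add: ext_kernel_minus_commute[of s y z])
          then show "ennreal (?q y x powr ?g) * ennreal (ext_kernel s y (x - z) * h z)
              = ennreal (h z) * ennreal (ext_kernel s y (z - x) * ?q y x powr ?g)"
            using h0[of z] by (metis ennreal_mult' powr_ge_zero)
        qed
        then show "(\<integral>\<^sup>+ x. ennreal (?q y x powr ?g) * ennreal (ext_kernel s y (x - z) * h z) \<partial>lebesgue)
          = ennreal (h z) * (\<integral>\<^sup>+ x. ennreal (ext_kernel s y (z - x) * ?q y x powr ?g) \<partial>lebesgue)"
          by (simp add: nn_integral_cmult)
      qed
      also have "\<dots> \<le> (\<integral>\<^sup>+ z. ennreal (h z) * ennreal (C2 * ?q y z powr ?g) \<partial>lebesgue)"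
        by (intro nn_integral_mono mult_left_mono dual y) auto
      also have "\<dots> = (\<integral>\<^sup>+ z. ennreal C2 * ennreal (\<bar>u z\<bar> powr p * ?q y z powr - \<alpha>) \<partial>lebesgue)"
      proof (intro nn_integral_cong)
        fix z :: 'a
        have "(?q y z powr b) powr (1 - p) * ?q y z powr ?g = ?q y z powr - \<alpha>"
          by (simp add: powr_powr powr_add[symmetric] algebra_simps)
        then have "h z * (C2 * ?q y z powr ?g) = C2 * (\<bar>u z\<bar> powr p * ?q y z powr - \<alpha>)"
          unfolding h_def by (simp add: algebra_simps)
        then show "ennreal (h z) * ennreal (C2 * ?q y z powr ?g) = ennreal C2 * ennreal (\<bar>u z\<bar> powr p * ?q y z powr - \<alpha>)"
          using h0[of z] C2 by (simp add: ennreal_mult'[symmetric])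
      qed
      also have "\<dots> = ennreal C2 * ?I"
        by (intro nn_integral_cmult) measurable
      finally show ?thesis .
    qed
    have "AE x in lebesgue. ennreal (?q y x powr ?g) * B x \<noteq> \<infinity>"
    proof (rule nn_integral_PInf_AE)
      have "ennreal C2 * ?I < \<infinity>"
        using fin by (simp add: ennreal_mult_less_top)
      with B_bound show "(\<integral>\<^sup>+ x. ennreal (?q y x powr ?g) * B x \<partial>lebesgue) \<noteq> \<infinity>"
        by (auto simp: top_unique)
    qed measurable
    then have B_fin: "AE x in lebesgue. B x \<noteq> \<infinity>"
    proof eventually_elim
      case (elim x)
      then show ?case using pos[of x] by (auto simp: ennreal_mult_top)
    qed
    have pointwise: "?T x < \<infinity> \<and> ennreal (enn2real (?T x) powr p * ?q y x powr - \<alpha>)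
        \<le> ennreal D * (ennreal (?q y x powr ?g) * B x)" if Bx: "B x \<noteq> \<infinity>" for x
    proof -
      obtain r where r: "B x = ennreal r" "0 \<le> r"
        using Bx by (cases "B x") auto
      have A: "0 < C1 * ?q y x powr b"
        using C1 pos[of x] by simp
      have qb: "0 < ?q y z powr b" for z
        using pos[of z] by simp
      note * = nn_integral_powr_le_weighted[of "\<lambda>z. ext_kernel s y (x - z)" lebesgue "\<lambda>z. ?q y z powr b"
          "\<lambda>z. \<bar>u z\<bar>" p, OF _ _ _ ext_kernel_nonneg qb abs_ge_zero p A mass[OF y]
          r(1)[unfolded B_def h_def] r(2)]
      have T: "?T x < \<infinity>" "enn2real (?T x) powr p \<le> 2 * (2 * (C1 * ?q y x powr b)) powr (p - 1) * r"
        by (rule *; measurable)+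
      have "2 * (2 * (C1 * ?q y x powr b)) powr (p - 1) = D * ?q y x powr (b * (p - 1))"
        using C1 by (simp add: D_def powr_mult powr_powr)
      with T(2) have "enn2real (?T x) powr p * ?q y x powr - \<alpha>
          \<le> D * ?q y x powr (b * (p - 1)) * r * ?q y x powr - \<alpha>"
        by (intro mult_right_mono) auto
      also have "\<dots> = D * (?q y x powr (b * (p - 1)) * ?q y x powr - \<alpha> * r)"
        by simp
      also have "?q y x powr (b * (p - 1)) * ?q y x powr - \<alpha> = ?q y x powr ?g"
        by (simp add: powr_add[symmetric])
      finally show ?thesis
        using T(1) D r by (simp add: ennreal_mult'[symmetric] ennreal_leI)
    qed
    have "AE x in lebesgue. ?T x < \<infinity>"
      using B_fin by eventually_elim (use pointwise in blast)
    moreover have "(\<integral>\<^sup>+ x. ennreal (enn2real (?T x) powr p * ?q y x powr - \<alpha>) \<partial>lebesgue)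
        \<le> (\<integral>\<^sup>+ x. ennreal D * (ennreal (?q y x powr ?g) * B x) \<partial>lebesgue)"
      by (rule nn_integral_mono_AE) (use B_fin in eventually_elim, use pointwise in blast)
    moreover have "\<dots> = ennreal D * (\<integral>\<^sup>+ x. ennreal (?q y x powr ?g) * B x \<partial>lebesgue)"
      by (rule nn_integral_cmult) measurable
    moreover have "\<dots> \<le> ennreal D * (ennreal C2 * ?I)"
      by (intro mult_left_mono B_bound) auto
    moreover have "\<dots> = ennreal (D * C2) * ?I"
      using D C2 by (simp add: ennreal_mult' mult.assoc)
    ultimately show ?thesis by simp
  qed
  moreover have "0 < D * C2" using D C2 by simp
  ultimately show ?thesis by blast
qed

text \<open>
  Up to \<open>n / 2 + s\<close> the constant test function suffices. Beyond, \<open>b\<close> is chosen as small as possible,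
  so that \<open>b * (p - 1) - \<alpha>\<close> is exactly the lower limit \<open>- (n / 2 + s)\<close>; then \<open>b < s\<close> is equivalent
  to \<open>\<alpha> < n / 2 + s * p\<close>.
\<close>

lemma exists_test_weight_exponent:
  fixes n s p \<alpha> :: real
  assumes s: "0 < s" and p: "1 \<le> p" and n: "0 < n" and \<alpha>: "0 \<le> \<alpha>"
    and sub: "if p = 1 then \<alpha> \<le> n / 2 + s else \<alpha> < n / 2 + s * p"
  obtains b where "0 \<le> b" "b < s" "- (n / 2 + s) \<le> b * (p - 1) - \<alpha>" "b * (p - 1) - \<alpha> < s"
proof (cases "\<alpha> \<le> n / 2 + s")
  case True
  with s \<alpha> show ?thesis by (intro that[of 0]) auto
next
  case False
  with sub p have p1: "1 < p" by (cases "p = 1") auto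
  define b where "b = (\<alpha> - n / 2 - s) / (p - 1)"
  have "b * (p - 1) = \<alpha> - n / 2 - s"
    using p1 by (simp add: b_def)
  moreover have "b < s"
    using p1 sub unfolding b_def by (simp add: divide_less_eq algebra_simps)
  moreover have "0 \<le> b"
    using False p1 by (simp add: b_def)
  ultimately show ?thesis using s n by (intro that[of b]) auto
qed

section \<open>A datum with divergent extension\<close>

text \<open>
  The growth \<open>norm z powr (2 * s)\<close> is what the kernel just fails to integrate; the logarithm keeps the
  divergence but makes the \<open>p\<close>-th power integrable against the critical weight for \<open>p > 1\<close>.
\<close>

definition divergent_datum :: "real \<Rightarrow> 'a::euclidean_space \<Rightarrow> real"
  where "divergent_datum s z =
    (if norm z < 1 then 0 else norm z powr (2 * s) / (1 + log 2 (norm z)))"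

lemma borel_measurable_divergent_datum [measurable]:
  "divergent_datum s \<in> borel_measurable borel"
  unfolding divergent_datum_def[abs_def] by measurable

text \<open>
  The shell of radius \<open>2 ^ k\<close> contributes at most a constant times
  \<open>k powr - p * 2 powr (k * (2 * s * p - 2 * \<alpha> + n))\<close>, where the exponential factor is \<open>1\<close> at the
  critical exponent and decays geometrically above it.
\<close>

lemma divergent_datum_weighted_finite:
  assumes s: "0 < s" and p: "1 \<le> p" and \<alpha>: "real DIM('a) / 2 + s * p \<le> \<alpha>"
    and crit: "1 < p \<or> real DIM('a) / 2 + s * p < \<alpha>"
  shows "(\<integral>\<^sup>+ z. ennreal (\<bar>divergent_datum s (z :: 'a::euclidean_space)\<bar> powr p * half_space_norm_sq 1 z powr - \<alpha>) \<partial>lebesgue) < \<infinity>"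
proof -
  let ?n = "real DIM('a)" let ?V = "unit_ball_vol (real DIM('a))"
  define e where "e = 2 * s * p - 2 * \<alpha>"
  have e: "e + ?n \<le> 0" "e \<le> 0"
    using \<alpha> s p by (auto simp: e_def algebra_simps intro: order_trans[of _ "- ?n"])
  \<comment> \<open>At \<open>k = 0\<close> this is \<open>0 powr - p = 0\<close>, matching the datum, which vanishes on the unit ball.\<close>
  define c where "c k = real k powr - p * (2 ^ k / 2) powr e" for k :: nat
  have "(\<integral>\<^sup>+ z. ennreal (\<bar>divergent_datum s (z :: 'a)\<bar> powr p * half_space_norm_sq 1 z powr - \<alpha>) \<partial>lebesgue)
      \<le> (\<Sum>k. ennreal (c k * (?V * (2 ^ k * 1) ^ DIM('a))))"
  proof (rule nn_integral_le_dyadic_sum[where x = 0])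
    fix k :: nat and z :: 'a
    assume z: "norm (0 - z) < 2 ^ k * 1" "k = 0 \<or> 2 ^ (k - 1) * 1 \<le> norm (0 - z)"
    show "ennreal (\<bar>divergent_datum s z\<bar> powr p * half_space_norm_sq 1 z powr - \<alpha>) \<le> ennreal (c k)"
    proof (cases "norm z < 1")
      case True
      then show ?thesis by (simp add: divergent_datum_def)
    next
      case False
      with z obtain l where l: "k = Suc l" by (cases k) auto
      with z have zl: "2 ^ l \<le> norm z" by simp
      have "real l = log 2 (2 ^ l)" by simp
      also have "\<dots> \<le> log 2 (norm z)"
        using zl False by (subst log_le_cancel_iff) auto
      finally have k_le: "real k \<le> 1 + log 2 (norm z)" using l by simp
      have "\<bar>divergent_datum s z\<bar> powr p = norm z powr (2 * s * p) * (1 + log 2 (norm z)) powr - p"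
        using False k_le l by (simp add: divergent_datum_def powr_divide powr_powr powr_minus_divide)
      moreover have "half_space_norm_sq 1 z powr - \<alpha> \<le> norm z powr (- 2 * \<alpha>)"
      proof -
        have "half_space_norm_sq 1 z powr - \<alpha> \<le> ((norm z)\<^sup>2) powr - \<alpha>"
          using False \<alpha> s p by (intro powr_mono2') (auto simp: half_space_norm_sq_def intro: order_trans[of _ "?n / 2 + s * p"])
        also have "\<dots> = norm z powr (- 2 * \<alpha>)"
          using False by (simp add: powr_powr powr_numeral[symmetric] del: powr_numeral)
        finally show ?thesis .
      qed
      ultimately have "\<bar>divergent_datum s z\<bar> powr p * half_space_norm_sq 1 z powr - \<alpha>
          \<le> norm z powr (2 * s * p) * (1 + log 2 (norm z)) powr - p * norm z powr (- 2 * \<alpha>)"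
        by (simp add: mult_left_mono)
      also have "\<dots> = (1 + log 2 (norm z)) powr - p * norm z powr e"
        by (simp add: e_def powr_diff powr_minus divide_inverse)
      also have "\<dots> \<le> real k powr - p * (2 ^ l) powr e"
        using k_le l p e(2) zl by (intro mult_mono powr_mono2') auto
      also have "\<dots> = c k"
        by (simp add: c_def l)
      finally show ?thesis by (rule ennreal_leI)
    qed
  qed (auto simp: c_def)
  also have "(\<lambda>k. c k * (?V * (2 ^ k * 1) ^ DIM('a)))
      = (\<lambda>k. ?V * 2 powr - e * (real k powr - p * (2 powr (e + ?n)) ^ k))"
  proof
    fix k :: nat
    have "(2 ^ k) powr e = (2 powr e :: real) ^ k"
      by (simp add: powr_realpow[symmetric] powr_powr mult.commute)
    then have "(2 ^ k / 2) powr e = (2 powr e) ^ k / 2 powr e"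
      by (simp add: powr_divide)
    then have "(2 ^ k / 2) powr e = 2 powr - e * (2 powr e) ^ k"
      by (simp only: powr_minus divide_inverse mult.commute)
    moreover have "(2 ^ k * 1) ^ DIM('a) = (2 powr ?n) ^ k"
      by (simp add: powr_realpow power_mult[symmetric] mult.commute)
    ultimately show "c k * (?V * (2 ^ k * 1) ^ DIM('a)) = ?V * 2 powr - e * (real k powr - p * (2 powr (e + ?n)) ^ k)"
      by (simp add: c_def powr_add power_mult_distrib)
  qed
  also have "(\<Sum>k. ennreal (?V * 2 powr - e * (real k powr - p * (2 powr (e + ?n)) ^ k))) < \<infinity>"
  proof -
    have "summable (\<lambda>k. real k powr - p * (2 powr (e + ?n)) ^ k)"
    proof (cases "1 < p")
      case True
      show ?thesis
      proof (rule summable_comparison_test')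
        show "summable (\<lambda>k. real k powr - p)"
          using True by (simp add: summable_real_powr_iff)
        have "2 powr (e + ?n) \<le> 1"
          using e(1) powr_mono[of "e + ?n" 0 2] by simp
        then show "norm (real k powr - p * (2 powr (e + ?n)) ^ k) \<le> real k powr - p" if "k \<ge> 0" for k
          by (simp add: mult_left_le power_le_one)
      qed
    next
      case False
      then have lt: "e + ?n < 0"
        using crit by (simp add: e_def algebra_simps)
      show ?thesis
      proof (rule summable_comparison_test')
        show "summable (\<lambda>k. (2 powr (e + ?n)) ^ k)"
          using lt by (intro summable_geometric) (simp add: powr_less_one)
        show "norm (real k powr - p * (2 powr (e + ?n)) ^ k) \<le> (2 powr (e + ?n)) ^ k" if "k \<ge> 1" for k
        proof -
          have "real k powr - p \<le> 1"
            using that p powr_mono2'[of "- p" 1 "real k"] by simp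
          then show ?thesis by (simp add: mult_right_le_one_le mult.commute)
        qed
      qed
    qed
    then have "(\<Sum>k. ennreal (?V * 2 powr - e * (real k powr - p * (2 powr (e + ?n)) ^ k))) \<noteq> top"
      by (intro ennreal_suminf_neq_top summable_mult) auto
    then show ?thesis by (simp add: top.not_eq_extremum)
  qed
  finally show ?thesis .
qed

text \<open>
  For fixed \<open>x\<close> and \<open>norm z \<ge> 1\<close> the kernel is at least a constant times
  \<open>norm z powr - (n + 2 * s)\<close>, so the integrand is at least a constant times
  \<open>norm z powr - n / (1 + log 2 (norm z))\<close>, and the shell of radius \<open>2 ^ k\<close> contributes a multiple of
  \<open>1 / (k + 2)\<close>.
\<close>

lemma divergent_datum_extension_infinite:
  fixes x :: "'a::euclidean_space"
  assumes s: "0 < s"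
  shows "(\<integral>\<^sup>+ z. ennreal (ext_kernel s 1 (x - z) * divergent_datum s z) \<partial>lebesgue) = \<infinity>"
proof -
  let ?n = "real DIM('a)" let ?V = "unit_ball_vol (real DIM('a))" let ?m = "real DIM('a) / 2 + s"
  define M where "M = 2 * (norm x)\<^sup>2 + 3"
  have M: "0 < M" by (simp add: M_def add_nonneg_pos)
  define c where "c k = M powr - ?m * (2 powr - ?n) * ((2 ^ k) powr - ?n / real (Suc (Suc k)))" for k :: nat
  have "(\<Sum>k. ennreal (c k * (?V * (2 ^ k) ^ DIM('a))))
      \<le> (\<integral>\<^sup>+ z. ennreal (ext_kernel s 1 (x - z) * divergent_datum s z) \<partial>lebesgue)"
  proof (rule nn_integral_ge_dyadic_sum)
    fix k :: nat and z :: 'a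
    assume z: "2 ^ k \<le> norm z" "norm z < 2 ^ Suc k"
    have z1: "1 \<le> norm z"
      using z(1) one_le_power[of "2::real" k] by linarith
    have "log 2 (norm z) \<le> log 2 (2 ^ Suc k)"
      using z z1 by (subst log_le_cancel_iff) auto
    also have "\<dots> = real (Suc k)"
      by (simp only: log_pow_cancel)
    finally have log: "1 + log 2 (norm z) \<le> real (Suc (Suc k))" by simp
    have log0: "0 \<le> log 2 (norm z)"
      using z1 by (subst zero_le_log_cancel_iff) auto
    have "half_space_norm_sq 1 (x - z) \<le> 2 * (norm x)\<^sup>2 + 2 * (norm z)\<^sup>2 + 1"
    proof -
      have "(norm (x - z))\<^sup>2 \<le> (norm x + norm z)\<^sup>2"
        by (intro power_mono norm_triangle_ineq4) auto
      also have "\<dots> \<le> 2 * (norm x)\<^sup>2 + 2 * (norm z)\<^sup>2"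
        using sum_squares_bound[of "norm x" "norm z"] by (simp add: power2_sum)
      finally show ?thesis by (simp add: half_space_norm_sq_def)
    qed
    also have "\<dots> \<le> M * (norm z)\<^sup>2"
    proof -
      have "1 \<le> (norm z)\<^sup>2" using z1 by simp
      moreover from this have "2 * (norm x)\<^sup>2 * 1 \<le> 2 * (norm x)\<^sup>2 * (norm z)\<^sup>2"
        by (intro mult_left_mono) auto
      ultimately show ?thesis unfolding M_def distrib_right by linarith
    qed
    finally have "(M * (norm z)\<^sup>2) powr - ?m \<le> half_space_norm_sq 1 (x - z) powr - ?m"
      using s by (intro powr_mono2' half_space_norm_sq_pos) auto
    also have "(M * (norm z)\<^sup>2) powr - ?m = M powr - ?m * norm z powr (- 2 * ?m)"
      using M z1 by (simp add: powr_mult powr_powr powr_numeral[symmetric] del: powr_numeral)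
    finally have kernel: "M powr - ?m * norm z powr (- 2 * ?m) \<le> ext_kernel s 1 (x - z)"
      by (simp add: ext_kernel_def)
    have "c k = M powr - ?m * ((2 ^ Suc k) powr - ?n / real (Suc (Suc k)))"
      by (simp add: c_def powr_mult mult_ac)
    also have "\<dots> \<le> M powr - ?m * (norm z powr - ?n / (1 + log 2 (norm z)))"
      using z z1 log log0 by (intro mult_left_mono frac_le powr_mono2') auto
    also have "norm z powr - ?n = norm z powr (- 2 * ?m) * norm z powr (2 * s)"
      by (simp add: powr_add[symmetric])
    also have "M powr - ?m * (norm z powr (- 2 * ?m) * norm z powr (2 * s) / (1 + log 2 (norm z)))
        = M powr - ?m * norm z powr (- 2 * ?m) * divergent_datum s z"
      using z1 by (simp add: divergent_datum_def)
    also have "\<dots> \<le> ext_kernel s 1 (x - z) * divergent_datum s z"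
      using z1 log0 by (intro mult_right_mono kernel) (simp add: divergent_datum_def)
    finally show "ennreal (c k) \<le> ennreal (ext_kernel s 1 (x - z) * divergent_datum s z)"
      by (rule ennreal_leI)
  qed (simp add: c_def)
  moreover have "(\<Sum>k. ennreal (c k * (?V * (2 ^ k) ^ DIM('a)))) = \<infinity>"
  proof (rule ccontr)
    assume "(\<Sum>k. ennreal (c k * (?V * (2 ^ k) ^ DIM('a)))) \<noteq> \<infinity>"
    then have "summable (\<lambda>k. c k * (?V * (2 ^ k) ^ DIM('a)))"
      by (intro summable_suminf_not_top) (auto simp: c_def)
    also have "(\<lambda>k. c k * (?V * (2 ^ k) ^ DIM('a)))
        = (\<lambda>k. M powr - ?m * (2 powr - ?n) * ?V * inverse (real (Suc (Suc k))))"
    proof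
      fix k :: nat
      have "(2 ^ k) powr - ?n * (2 ^ k) ^ DIM('a) = (1::real)"
        by (simp add: powr_minus powr_realpow)
      then have "(2 ^ k) powr - ?n / real (Suc (Suc k)) * (2 ^ k) ^ DIM('a) = inverse (real (Suc (Suc k)))"
        by (simp add: divide_inverse mult_ac del: of_nat_Suc)
      then show "c k * (?V * (2 ^ k) ^ DIM('a)) = M powr - ?m * (2 powr - ?n) * ?V * inverse (real (Suc (Suc k)))"
        unfolding c_def by (metis (no_types, opaque_lifting) mult.assoc mult.commute)
    qed
    finally have "summable (\<lambda>k. inverse (real (Suc (Suc k))))"
      using M unit_ball_vol_pos[of ?n] by (subst (asm) summable_cmult_iff) (auto simp del: unit_ball_vol_pos)
    then have "summable (\<lambda>k. inverse (real k))"
      by (simp only: summable_Suc_iff[of "\<lambda>k. inverse (real (Suc k))"] summable_Suc_iff[of "\<lambda>k. inverse (real k)"])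
    then show False
      using not_summable_harmonic[where 'a = real] by simp
  qed
  ultimately show ?thesis by (simp add: top_unique)
qed

section \<open>The characterisation of the admissible weights\<close>

lemma harmonic_ext_integrand_eq:
  fixes x z :: "real ^ 'n"
  shows "harmonic_ext_integrand s u x y z = ext_kernel s y (x - z) * u z"
proof -
  have "(real CARD('n) + 2 * s) / 2 = real CARD('n) / 2 + s" by simp
  then show ?thesis
    by (simp only: harmonic_ext_integrand_def ext_kernel_def half_space_norm_sq_def DIM_cart DIM_real mult_1_right mult_1_left
        powr_minus divide_inverse mult_ac)
qed

lemma weighted_integral_eq:
  "weighted_integral \<alpha> p y u = (\<integral>\<^sup>+ z. ennreal (\<bar>u z\<bar> powr p * half_space_norm_sq y z powr - \<alpha>) \<partial>lebesgue)"
  by (simp only: weighted_integral_def half_space_norm_sq_def powr_minus divide_inverse)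

lemma borel_measurable_harmonic_ext_integrand:
  assumes "u \<in> borel_measurable lebesgue"
  shows "harmonic_ext_integrand s u x y \<in> borel_measurable lebesgue"
  unfolding harmonic_ext_integrand_eq[abs_def] using assms by measurable

lemma weighted_bound_holds_subcritical:
  assumes s: "0 < s" and \<alpha>: "0 \<le> \<alpha>" and p: "1 \<le> p"
    and sub: "if p = 1 then \<alpha> \<le> real CARD('n) / 2 + s else \<alpha> < real CARD('n) / 2 + s * p"
  shows "weighted_bound_holds TYPE('n::finite) s \<alpha> p"
proof -
  obtain b where b: "0 \<le> b" "b < s" "- (real CARD('n) / 2 + s) \<le> b * (p - 1) - \<alpha>" "b * (p - 1) - \<alpha> < s"
    using exists_test_weight_exponent[OF s p _ \<alpha> sub] by auto
  obtain C where C: "C > 0" and *: "\<And>y (u :: real ^ 'n \<Rightarrow> real). 0 < y \<Longrightarrow> u \<in> borel_measurable lebesgue \<Longrightarrow>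
      (\<integral>\<^sup>+ z. ennreal (\<bar>u z\<bar> powr p * half_space_norm_sq y z powr - \<alpha>) \<partial>lebesgue) < \<infinity> \<Longrightarrow>
      (AE x in lebesgue. (\<integral>\<^sup>+ z. ennreal (ext_kernel s y (x - z) * \<bar>u z\<bar>) \<partial>lebesgue) < \<infinity>) \<and>
      (\<integral>\<^sup>+ x. ennreal (enn2real (\<integral>\<^sup>+ z. ennreal (ext_kernel s y (x - z) * \<bar>u z\<bar>) \<partial>lebesgue) powr p
        * half_space_norm_sq y x powr - \<alpha>) \<partial>lebesgue)
      \<le> ennreal C * (\<integral>\<^sup>+ z. ennreal (\<bar>u z\<bar> powr p * half_space_norm_sq y z powr - \<alpha>) \<partial>lebesgue)"
    using weighted_ext_kernel_bound[OF s p b(1,2), where ?'a = "real ^ 'n" and \<alpha> = \<alpha>] b(3,4) by auto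
  define c where "c = \<bar>harmonic_ext_const CARD('n) s\<bar>"
  \<comment> \<open>The summand \<open>1\<close> only makes the constant positive.\<close>
  define E where "E = (c powr p + 1) * C"
  have "(AE x in lebesgue. integrable lebesgue (harmonic_ext_integrand s u x y)) \<and>
      weighted_integral \<alpha> p y (\<lambda>x. harmonic_ext s u x y) \<le> ennreal E * weighted_integral \<alpha> p y u"
    if y: "0 < y" and u: "u \<in> borel_measurable lebesgue" and fin: "weighted_integral \<alpha> p y u < \<infinity>"
    for y and u :: "real ^ 'n \<Rightarrow> real"
  proof -
    let ?T = "\<lambda>x. \<integral>\<^sup>+ z. ennreal (ext_kernel s y (x - z) * \<bar>u z\<bar>) \<partial>lebesgue"
    note bound = *[OF y u fin[unfolded weighted_integral_eq]]
    have norm_eq: "(\<integral>\<^sup>+ z. ennreal (norm (harmonic_ext_integrand s u x y z)) \<partial>lebesgue) = ?T x" for x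
      by (simp add: harmonic_ext_integrand_eq abs_mult ext_kernel_nonneg)
    have integrable: "AE x in lebesgue. integrable lebesgue (harmonic_ext_integrand s u x y)"
      using bound[THEN conjunct1]
    proof eventually_elim
      case (elim x)
      then show ?case
        by (intro integrableI_bounded borel_measurable_harmonic_ext_integrand u) (simp add: norm_eq[unfolded real_norm_def])
    qed
    have "\<bar>harmonic_ext s u x y\<bar> \<le> c * enn2real (?T x)" for x
    proof -
      have "\<bar>LINT z|lebesgue. harmonic_ext_integrand s u x y z\<bar> \<le> enn2real (?T x)"
      proof (rule order_trans)
        show "\<bar>LINT z|lebesgue. harmonic_ext_integrand s u x y z\<bar>
            \<le> (LINT z|lebesgue. norm (harmonic_ext_integrand s u x y z))"
          using integral_norm_bound[of lebesgue "harmonic_ext_integrand s u x y"] by simp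
        show "(LINT z|lebesgue. norm (harmonic_ext_integrand s u x y z)) \<le> enn2real (?T x)"
          using borel_measurable_harmonic_ext_integrand[OF u, of s x y]
          by (subst integral_eq_nn_integral) (auto simp: norm_eq[unfolded real_norm_def])
      qed
      then show ?thesis
        by (simp add: harmonic_ext_def c_def abs_mult mult_left_mono)
    qed
    then have "\<bar>harmonic_ext s u x y\<bar> powr p \<le> (c powr p + 1) * enn2real (?T x) powr p" for x
    proof -
      have "\<bar>harmonic_ext s u x y\<bar> powr p \<le> (c * enn2real (?T x)) powr p"
        using p \<open>\<bar>harmonic_ext s u x y\<bar> \<le> c * enn2real (?T x)\<close> by (intro powr_mono2) auto
      also have "\<dots> \<le> (c powr p + 1) * enn2real (?T x) powr p"
        by (simp add: powr_mult c_def distrib_right)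
      finally show ?thesis .
    qed
    then have "weighted_integral \<alpha> p y (\<lambda>x. harmonic_ext s u x y)
        \<le> (\<integral>\<^sup>+ x. ennreal (c powr p + 1) * ennreal (enn2real (?T x) powr p * half_space_norm_sq y x powr - \<alpha>) \<partial>lebesgue)"
      unfolding weighted_integral_eq
      by (intro nn_integral_mono) (simp add: ennreal_mult'[symmetric] ennreal_leI mult_right_mono mult.assoc[symmetric] del: ennreal_plus)
    also have "\<dots> = ennreal (c powr p + 1) * (\<integral>\<^sup>+ x. ennreal (enn2real (?T x) powr p * half_space_norm_sq y x powr - \<alpha>) \<partial>lebesgue)"
    proof (rule nn_integral_cmult)
      interpret sigma_finite_measure "lebesgue :: (real ^ 'n) measure"
        by (rule sigma_finite_lebesgue)
      note [measurable] = u
      show "(\<lambda>x. ennreal (enn2real (?T x) powr p * half_space_norm_sq y x powr - \<alpha>)) \<in> borel_measurable lebesgue"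
        by measurable
    qed
    also have "\<dots> \<le> ennreal (c powr p + 1) * (ennreal C * weighted_integral \<alpha> p y u)"
      using bound unfolding weighted_integral_eq by (intro mult_left_mono) auto
    also have "\<dots> = ennreal E * weighted_integral \<alpha> p y u"
      using C by (simp add: E_def ennreal_mult' mult.assoc del: ennreal_plus)
    finally show ?thesis using integrable by blast
  qed
  moreover have "0 < E" using C by (simp add: E_def add_nonneg_pos)
  ultimately show ?thesis unfolding weighted_bound_holds_def by blast
qed

text \<open>
  Height \<open>y = 1\<close> and the single function \<open>divergent_datum s\<close> suffice: its weighted norm is finite but
  its extension converges absolutely at no point, so the inequality fails before any constant matters.
\<close>

lemma weighted_bound_fails_from_critical_exponent:
  assumes s: "0 < s" and p: "1 \<le> p" and \<alpha>: "real CARD('n) / 2 + s * p \<le> \<alpha>"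
    and crit: "1 < p \<or> real CARD('n) / 2 + s * p < \<alpha>"
  shows "\<not> weighted_bound_holds TYPE('n::finite) s \<alpha> p"
proof
  assume "weighted_bound_holds TYPE('n) s \<alpha> p"
  moreover let ?u = "divergent_datum s :: real ^ 'n \<Rightarrow> real"
  have "weighted_integral \<alpha> p 1 ?u < \<infinity>"
    unfolding weighted_integral_eq using divergent_datum_weighted_finite[OF s p, where ?'a = "real ^ 'n"] \<alpha> crit by simp
  moreover have meas: "?u \<in> borel_measurable lebesgue"
    by (rule measurable_completion) (simp add: borel_measurable_divergent_datum)
  ultimately have "AE x in lebesgue. integrable lebesgue (harmonic_ext_integrand s ?u x 1)"
    unfolding weighted_bound_holds_def by (metis zero_less_one)
  moreover have "\<not> integrable lebesgue (harmonic_ext_integrand s ?u x 1)" for x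
  proof
    assume "integrable lebesgue (harmonic_ext_integrand s ?u x 1)"
    then have "(\<integral>\<^sup>+ z. ennreal (norm (harmonic_ext_integrand s ?u x 1 z)) \<partial>lebesgue) < \<infinity>"
      by (simp add: integrable_iff_bounded)
    moreover have "norm (harmonic_ext_integrand s ?u x 1 z) = ext_kernel s 1 (x - z) * ?u z" for z
    proof -
      have "0 \<le> log 2 (norm z)" if "1 \<le> norm z"
        using that by (subst zero_le_log_cancel_iff) auto
      then have "0 \<le> ?u z"
        by (simp add: divergent_datum_def)
      then show ?thesis
        by (simp add: harmonic_ext_integrand_eq ext_kernel_nonneg)
    qed
    ultimately show False
      using divergent_datum_extension_infinite[OF s, of x] by simp
  qed
  ultimately have "AE x in (lebesgue :: (real ^ 'n) measure). False"
    by simp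
  then show False
    by (simp add: AE_iff_null null_sets_completion_iff null_sets_def)
qed

theorem theorem1:
  fixes s \<alpha> :: real
  assumes "0 < s" and "s < 1" and "0 \<le> \<alpha>"
  shows "(weighted_bound_holds TYPE('n::finite) s \<alpha> 1 \<longleftrightarrow> \<alpha> \<le> real CARD('n) / 2 + s) \<and>
    (\<forall>p::real. 1 < p \<longrightarrow>
      (weighted_bound_holds TYPE('n) s \<alpha> p \<longleftrightarrow> \<alpha> < real CARD('n) / 2 + s * p))"
proof (intro conjI allI impI)
  show "weighted_bound_holds TYPE('n) s \<alpha> 1 \<longleftrightarrow> \<alpha> \<le> real CARD('n) / 2 + s"
    using weighted_bound_holds_subcritical[OF assms(1,3), of 1, where ?'n = 'n]
      weighted_bound_fails_from_critical_exponent[OF assms(1), of 1 \<alpha>, where ?'n = 'n]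
    by (cases "\<alpha> \<le> real CARD('n) / 2 + s") auto
  fix p :: real assume "1 < p"
  then show "weighted_bound_holds TYPE('n) s \<alpha> p \<longleftrightarrow> \<alpha> < real CARD('n) / 2 + s * p"
    using weighted_bound_holds_subcritical[OF assms(1,3), of p, where ?'n = 'n]
      weighted_bound_fails_from_critical_exponent[OF assms(1), of p \<alpha>, where ?'n = 'n]
    by (cases "\<alpha> < real CARD('n) / 2 + s * p") auto
qed

end
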